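(* There exists $n_0 \in \mathbb{N}$ such that for all integers $n \geq n_0$, the $n$-queens completion threshold satisfies $qc(n) < 0.216\,n$.
   Context: For $n \in \mathbb{N}$, write $[n] = \{1, 2, \dots, n\}$ and identify the squares of the $n \times n$ chessboard with $[n] \times [n]$, where $(i,j)$ is the square in row $i$ and column $j$. The lines of the board are the rows $R_i = \{(i,j) : j \in [n]\}$ for $i \in [n]$, the columns $C_j = \{(i,j) : i \in [n]\}$ for $j \in [n]$, the diagonals $D_k^- = \{(i,j) \in [n] \times [n] : j - i + n = k\}$ for $k \in [2n-1]$, and the anti-diagonals $D_k^+ = \{(i,j) \in [n] \times [n] : i + j - 1 = k\}$ for $k \in [2n-1]$. A partial $n$-queens configuration is a set $Q' \subseteq [n] \times [n]$ of mutually non-attacking queens, i.e. a set containing at most one square of each row, each column, each diagonal and each anti-diagonal (so necessarily $|Q'| \leq n$). An $n$-queens configuration is a partial $n$-queens configuration of cardinality exactly $n$. A partial $n$-queens configuration $Q'$ can be completed (is completable) if there is a set $U \subseteq [n] \times [n]$ with $Q' \cap U = \emptyset$ such that $Q' \cup U$ is an $n$-queens configuration (so $|U| = n - |Q'|$). The $n$-queens completion threshold $qc(n)$ is the largest integer $k < n$ such that every partial $n$-queens configuration consisting of $k$ or fewer queens can be completed to an $n$-queens configuration. (For every $n \geq 4$ an $n$-queens configuration exists, so the empty partial configuration is completable and $qc(n) \geq 0$ is well defined.) *)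

theory Defs
  imports Complex_Main
begin

type_synonym square = "nat \<times> nat"

definition board :: "nat \<Rightarrow> square set" where
  "board n = {1..n} \<times> {1..n}"

definition board_row :: "nat \<Rightarrow> nat \<Rightarrow> square set" where
  "board_row n i = {(i, j) | j. j \<in> {1..n}}"

definition board_column :: "nat \<Rightarrow> nat \<Rightarrow> square set" where
  "board_column n j = {(i, j) | i. i \<in> {1..n}}"

text \<open>The diagonals are the sets \<open>j - i + n = k\<close> and the anti-diagonals the sets
  \<open>i + j - 1 = k\<close>, for \<open>k \<in> {1..2 * n - 1}\<close>; both equations are written without the
  truncated subtraction of natural numbers.\<close>

definition diagonal :: "nat \<Rightarrow> nat \<Rightarrow> square set" where
  "diagonal n k = {(i, j) \<in> board n. j + n = k + i}"

definition antidiagonal :: "nat \<Rightarrow> nat \<Rightarrow> square set" where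
  "antidiagonal n k = {(i, j) \<in> board n. i + j = k + 1}"

definition partial_queens :: "nat \<Rightarrow> square set \<Rightarrow> bool" where
  "partial_queens n Q \<longleftrightarrow>
     Q \<subseteq> board n \<and>
     (\<forall>i\<in>{1..n}. card (Q \<inter> board_row n i) \<le> 1) \<and>
     (\<forall>j\<in>{1..n}. card (Q \<inter> board_column n j) \<le> 1) \<and>
     (\<forall>k\<in>{1..2 * n - 1}. card (Q \<inter> diagonal n k) \<le> 1) \<and>
     (\<forall>k\<in>{1..2 * n - 1}. card (Q \<inter> antidiagonal n k) \<le> 1)"

definition queens :: "nat \<Rightarrow> square set \<Rightarrow> bool" where
  "queens n Q \<longleftrightarrow> partial_queens n Q \<and> card Q = n"

definition completable :: "nat \<Rightarrow> square set \<Rightarrow> bool" where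
  "completable n Q \<longleftrightarrow> (\<exists>U. U \<subseteq> board n \<and> Q \<inter> U = {} \<and> queens n (Q \<union> U))"

text \<open>The set below is bounded by \<open>n\<close>, and for \<open>n \<ge> 4\<close> it contains \<open>0\<close> because an
  \<open>n\<close>-queens configuration exists. For \<open>n \<in> {0, 2, 3}\<close> it is empty, so the value of
  \<open>qc n\<close> is then unspecified.\<close>

definition qc :: "nat \<Rightarrow> nat" where
  "qc n = Max {k. k < n \<and> (\<forall>Q. partial_queens n Q \<and> card Q \<le> k \<longrightarrow> completable n Q)}"

end

theory Submission
  imports Defs
begin

text \<open>
  A set of about \<open>0.2159 n\<close> queens packed into the centre of the board cannot be completed.

  Put coordinates \<open>x\<close>, \<open>y\<close> with origin at the centre of the board and fix \<open>a > 0\<close>.  Give a row or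
  column with coordinate \<open>x\<close> the weight \<open>F x = a - 2 \<bar>\<bar>x\<bar> - a\<bar>\<close>, and a diagonal with
  coordinate \<open>u\<close> (\<open>u = x - y\<close> or \<open>u = x + y\<close>) the weight \<open>H u = 2 max 0 (a - \<bar>u\<bar>)\<close>.  Since
  \<open>\<bar>\<bar>x\<bar> - \<bar>y\<bar>\<bar>\<close> is the smaller of \<open>\<bar>x - y\<bar>\<close> and \<open>\<bar>x + y\<bar>\<close>, the triangle inequality gives
  \<open>F x + F y \<le> 2 a - 2 \<bar>\<bar>x\<bar> - \<bar>y\<bar>\<bar> \<le> H (x - y) + H (x + y)\<close> on every square
  (\<open>surplus_nonneg\<close>).  Sum the difference of the two sides, the surplus, over an \<open>n\<close>-queens
  configuration.  Rows and columns are all used, so they contribute a constant; diagonals are used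
  at most once, so each of the two families contributes at most \<open>2 a\<^sup>2\<close>.  The total surplus is
  therefore at most about \<open>12 a\<^sup>2 - 6 a n + n\<^sup>2\<close> (\<open>queens_surplus_le\<close>), and no configuration
  with a larger total is completable (\<open>not_completable_if_surplus\<close>).

  A queen close to the centre has a surplus of at least
  \<open>6 a - 2 (\<bar>x\<bar> + \<bar>y\<bar> + \<bar>x - y\<bar> + \<bar>x + y\<bar>)\<close>.  Place \<open>k\<close> queens in a central
  \<open>k \<times> k\<close> square along two parallel lines of slope two.  Three of the four coordinates
  \<open>x\<close>, \<open>y\<close>, \<open>x - y\<close>, \<open>x + y\<close> then essentially fill an interval of length \<open>k\<close>, and the sum of the four
  absolute values over the block is about \<open>7/6 k\<^sup>2\<close>, so that the block has surplus about
  \<open>6 a k - 7/3 k\<^sup>2\<close> (\<open>central_block_surplus\<close>).  With the best choice \<open>a = (n + k)/4\<close> this exceeds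
  the bound for full configurations as soon as \<open>19 k\<^sup>2 - 18 k n + 3 n\<^sup>2 < 0\<close>, that is
  \<open>k/n > (9 - sqrt 24)/19 = 0.21584...\<close>.  The proof uses \<open>k/n\<close> close to \<open>19/88 = 0.21590...\<close>,
  which leaves room on both sides, and the lower order terms are absorbed for large \<open>n\<close>.

  The threshold is a maximum, which is meaningful only if some \<open>k\<close>, equivalently \<open>k = 0\<close>,
  qualifies.  This requires an \<open>n\<close>-queens configuration for every large \<open>n\<close>; the classical
  explicit ones are verified in \<open>queens_exists\<close>.
\<close>

section \<open>Attacks in terms of coordinates\<close>

lemma card_lines_le_one_iff:
  assumes "finite Q"
    and "\<And>p. p \<in> Q \<Longrightarrow> f p \<in> K"
    and "\<And>p k. p \<in> Q \<Longrightarrow> k \<in> K \<Longrightarrow> p \<in> L k \<longleftrightarrow> f p = k"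
  shows "(\<forall>k\<in>K. card (Q \<inter> L k) \<le> 1) \<longleftrightarrow> inj_on f Q"
proof -
  have "card (Q \<inter> L k) \<le> 1 \<longleftrightarrow> (\<forall>p\<in>Q. \<forall>q\<in>Q. f p = k \<longrightarrow> f q = k \<longrightarrow> p = q)" if "k \<in> K" for k
  proof -
    have "Q \<inter> L k = {p \<in> Q. f p = k}" using assms(3) that by auto
    then show ?thesis using card_le_Suc0_iff_eq[of "{p \<in> Q. f p = k}"] assms(1) by auto
  qed
  then show ?thesis unfolding inj_on_def using assms(2) by metis
qed

lemma inj_on_pair_iff:
  "inj_on (\<lambda>(i, j). f i j) Q \<longleftrightarrow>
     (\<forall>i j i' j'. (i, j) \<in> Q \<longrightarrow> (i', j') \<in> Q \<longrightarrow> (i, j) \<noteq> (i', j') \<longrightarrow> f i j \<noteq> f i' j')"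
  unfolding inj_on_def by (auto simp: Ball_def)

text \<open>The conditions on cardinalities of line intersections become pairwise conditions in which the
  diagonals are compared through \<open>i + j' = i' + j\<close>, so that linear arithmetic on naturals applies
  without truncated subtraction.\<close>

lemma partial_queens_iff:
  "partial_queens n Q \<longleftrightarrow> Q \<subseteq> board n \<and>
     (\<forall>i j i' j'. (i, j) \<in> Q \<longrightarrow> (i', j') \<in> Q \<longrightarrow> (i, j) \<noteq> (i', j') \<longrightarrow>
        i \<noteq> i' \<and> j \<noteq> j' \<and> i + j' \<noteq> i' + j \<and> i + j \<noteq> i' + j')"
proof (cases "Q \<subseteq> board n")
  case True
  then have fin: "finite Q" by (rule finite_subset) (simp add: board_def)
  have range: "1 \<le> i \<and> i \<le> n \<and> 1 \<le> j \<and> j \<le> n" if "(i, j) \<in> Q" for i j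
    using that True by (auto simp: board_def)
  have row: "(\<forall>i\<in>{1..n}. card (Q \<inter> board_row n i) \<le> 1) \<longleftrightarrow> inj_on (\<lambda>(i, j). i) Q"
    by (rule card_lines_le_one_iff[OF fin]) (use range in \<open>force simp: board_row_def\<close>)+
  have col: "(\<forall>j\<in>{1..n}. card (Q \<inter> board_column n j) \<le> 1) \<longleftrightarrow> inj_on (\<lambda>(i, j). j) Q"
    by (rule card_lines_le_one_iff[OF fin]) (use range in \<open>force simp: board_column_def\<close>)+
  have dia: "(\<forall>k\<in>{1..2 * n - 1}. card (Q \<inter> diagonal n k) \<le> 1) \<longleftrightarrow> inj_on (\<lambda>(i, j). j + n - i) Q"
  proof (rule card_lines_le_one_iff[OF fin])
    show "(case p of (i, j) \<Rightarrow> j + n - i) \<in> {1..2 * n - 1}" if "p \<in> Q" for p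
      using range that by (cases p) fastforce
    show "p \<in> diagonal n k \<longleftrightarrow> (case p of (i, j) \<Rightarrow> j + n - i) = k" if "p \<in> Q" for p k
      using range[of "fst p" "snd p"] that by (cases p) (auto simp: diagonal_def board_def)
  qed
  have anti: "(\<forall>k\<in>{1..2 * n - 1}. card (Q \<inter> antidiagonal n k) \<le> 1) \<longleftrightarrow> inj_on (\<lambda>(i, j). i + j - 1) Q"
  proof (rule card_lines_le_one_iff[OF fin])
    show "(case p of (i, j) \<Rightarrow> i + j - 1) \<in> {1..2 * n - 1}" if "p \<in> Q" for p
      using range that by (cases p) fastforce
    show "p \<in> antidiagonal n k \<longleftrightarrow> (case p of (i, j) \<Rightarrow> i + j - 1) = k" if "p \<in> Q" for p k
      using range[of "fst p" "snd p"] that by (cases p) (auto simp: antidiagonal_def board_def)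
  qed
  have d: "inj_on (\<lambda>(i, j). j + n - i) Q \<longleftrightarrow>
      (\<forall>i j i' j'. (i, j) \<in> Q \<longrightarrow> (i', j') \<in> Q \<longrightarrow> (i, j) \<noteq> (i', j') \<longrightarrow> i + j' \<noteq> i' + j)"
  proof -
    have "j + n - i = j' + n - i' \<longleftrightarrow> i + j' = i' + j" if "(i, j) \<in> Q" "(i', j') \<in> Q" for i j i' j'
      using range[OF that(1)] range[OF that(2)] by auto
    then show ?thesis unfolding inj_on_pair_iff by meson
  qed
  have a: "inj_on (\<lambda>(i, j). i + j - 1) Q \<longleftrightarrow>
      (\<forall>i j i' j'. (i, j) \<in> Q \<longrightarrow> (i', j') \<in> Q \<longrightarrow> (i, j) \<noteq> (i', j') \<longrightarrow> i + j \<noteq> i' + j')"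
  proof -
    have "i + j - 1 = i' + j' - 1 \<longleftrightarrow> i + j = i' + j'" if "(i, j) \<in> Q" "(i', j') \<in> Q" for i j i' j'
      using range[OF that(1)] range[OF that(2)] by auto
    then show ?thesis unfolding inj_on_pair_iff by meson
  qed
  show ?thesis
    unfolding partial_queens_def row col dia anti d a
    unfolding inj_on_pair_iff using True
    by (intro iffI; elim conjE; intro conjI allI impI; (assumption | metis))
qed (simp add: partial_queens_def)

lemma partial_queens_on_board: "partial_queens n Q \<Longrightarrow> Q \<subseteq> board n"
  by (simp add: partial_queens_def)

lemma partial_queens_not_attacking:
  assumes "partial_queens n Q" "(i, j) \<in> Q" "(i', j') \<in> Q" "(i, j) \<noteq> (i', j')"
  shows "i \<noteq> i' \<and> j \<noteq> j' \<and> i + j' \<noteq> i' + j \<and> i + j \<noteq> i' + j'"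
proof -
  note conjunct2[OF assms(1)[unfolded partial_queens_iff]]
  from this[rule_format, OF assms(2,3)] assms(4) show ?thesis by fast
qed

text \<open>An \<open>n\<close>-queens configuration meets every row and every column exactly once, whereas it only
  leaves the diagonals and anti-diagonals without repetition.  This asymmetry is what the weights
  below exploit.\<close>

lemma queens_lines_bij:
  assumes "queens n Q"
  shows "bij_betw fst Q {1..n}" "bij_betw snd Q {1..n}"
    "inj_on (\<lambda>(i, j). int i - int j) Q" "inj_on (\<lambda>(i, j). int i + int j) Q"
proof -
  have pq: "partial_queens n Q" and card: "card Q = n" using assms by (auto simp: queens_def)
  note sub = partial_queens_on_board[OF pq] and dist = partial_queens_not_attacking[OF pq]
  have 1: "inj_on fst Q"
  proof (rule inj_onI)
    fix p q assume "p \<in> Q" "q \<in> Q" "fst p = fst q"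
    then show "p = q" using dist[of "fst p" "snd p" "fst q" "snd q"] by (metis prod.collapse)
  qed
  have 2: "inj_on snd Q"
  proof (rule inj_onI)
    fix p q assume "p \<in> Q" "q \<in> Q" "snd p = snd q"
    then show "p = q" using dist[of "fst p" "snd p" "fst q" "snd q"] by (metis prod.collapse)
  qed
  have "fst ` Q \<subseteq> {1..n}" "snd ` Q \<subseteq> {1..n}" using sub by (auto simp: board_def)
  then show "bij_betw fst Q {1..n}" "bij_betw snd Q {1..n}"
    using 1 2 card by (simp_all add: bij_betw_def card_image card_subset_eq)
  show "inj_on (\<lambda>(i, j). int i - int j) Q"
    unfolding inj_on_pair_iff
  proof (intro allI impI)
    fix i j i' j' assume "(i, j) \<in> Q" "(i', j') \<in> Q" "(i, j) \<noteq> (i', j')"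
    then have "i + j' \<noteq> i' + j" using dist by blast
    then show "int i - int j \<noteq> int i' - int j'" by linarith
  qed
  show "inj_on (\<lambda>(i, j). int i + int j) Q"
    unfolding inj_on_pair_iff
  proof (intro allI impI)
    fix i j i' j' assume "(i, j) \<in> Q" "(i', j') \<in> Q" "(i, j) \<noteq> (i', j')"
    then have "i + j \<noteq> i' + j'" using dist by blast
    then show "int i + int j \<noteq> int i' + int j'" by linarith
  qed
qed

section \<open>A weight inequality for queens configurations\<close>

definition line_weight :: "int \<Rightarrow> int \<Rightarrow> int" where
  "line_weight a x = a - 2 * \<bar>\<bar>x\<bar> - a\<bar>"

definition diag_weight :: "int \<Rightarrow> int \<Rightarrow> int" where
  "diag_weight a u = 2 * max 0 (a - \<bar>u\<bar>)"

definition surplus :: "int \<Rightarrow> int \<Rightarrow> int \<Rightarrow> int" where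
  "surplus a x y = diag_weight a (x - y) + diag_weight a (x + y) - line_weight a x - line_weight a y"

text \<open>Reflecting into the quadrant \<open>x, y \<ge> 0\<close>, the distance of \<open>\<bar>x\<bar>\<close> and \<open>\<bar>y\<bar>\<close> is at most the sum
  of their distances to \<open>a\<close>; it is also one of the two diagonal coordinates, up to sign, so one of
  the diagonal weights alone pays for both line weights.\<close>

lemma surplus_nonneg: "0 \<le> surplus a x y"
proof -
  have "\<bar>\<bar>x\<bar> - \<bar>y\<bar>\<bar> \<le> \<bar>\<bar>x\<bar> - a\<bar> + \<bar>\<bar>y\<bar> - a\<bar>" by linarith
  moreover have "\<bar>\<bar>x\<bar> - \<bar>y\<bar>\<bar> = \<bar>x - y\<bar> \<or> \<bar>\<bar>x\<bar> - \<bar>y\<bar>\<bar> = \<bar>x + y\<bar>" by linarith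
  moreover have "0 \<le> diag_weight a (x - y)" "0 \<le> diag_weight a (x + y)"
    "2 * (a - \<bar>x - y\<bar>) \<le> diag_weight a (x - y)" "2 * (a - \<bar>x + y\<bar>) \<le> diag_weight a (x + y)"
    by (simp_all add: diag_weight_def max_def)
  ultimately show ?thesis unfolding surplus_def line_weight_def by fastforce
qed

text \<open>Equality holds near the centre, where \<open>\<bar>x\<bar>\<close>, \<open>\<bar>y\<bar>\<close>, \<open>\<bar>x - y\<bar>\<close> and
  \<open>\<bar>x + y\<bar>\<close> do not exceed \<open>a\<close>.\<close>

lemma surplus_ge: "6 * a - 2 * (\<bar>x\<bar> + \<bar>y\<bar> + \<bar>x - y\<bar> + \<bar>x + y\<bar>) \<le> surplus a x y"
proof -
  have "2 * (a - \<bar>x - y\<bar>) \<le> diag_weight a (x - y)" "2 * (a - \<bar>x + y\<bar>) \<le> diag_weight a (x + y)"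
    by (simp_all add: diag_weight_def max_def)
  moreover have "a - \<bar>x\<bar> \<le> \<bar>\<bar>x\<bar> - a\<bar>" "a - \<bar>y\<bar> \<le> \<bar>\<bar>y\<bar> - a\<bar>" by simp_all
  ultimately show ?thesis unfolding surplus_def line_weight_def by (simp add: algebra_simps)
qed

lemma sum_tent: "(\<Sum>d\<in>{- int a..int a}. \<bar>\<bar>d\<bar> - int a\<bar>) = (int a)\<^sup>2"
proof (induction a)
  case (Suc a)
  have "{- int (Suc a)..int (Suc a)} = insert (- int (Suc a)) (insert (int (Suc a)) {- int a..int a})"
    by auto
  then have "(\<Sum>d\<in>{- int (Suc a)..int (Suc a)}. \<bar>\<bar>d\<bar> - int (Suc a)\<bar>)
      = (\<Sum>d\<in>{- int a..int a}. \<bar>\<bar>d\<bar> - int (Suc a)\<bar>)"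
    by simp
  also have "\<dots> = (\<Sum>d\<in>{- int a..int a}. \<bar>\<bar>d\<bar> - int a\<bar> + 1)"
    by (rule sum.cong) auto
  also have "\<dots> = (int (Suc a))\<^sup>2"
    unfolding sum.distrib Suc.IH by (simp add: power2_eq_square algebra_simps)
  finally show ?case .
qed simp

lemma sum_dist_tent:
  "(\<Sum>d\<in>{- int (a + r)..int (a + r)}. \<bar>\<bar>d\<bar> - int a\<bar>) = (int a)\<^sup>2 + int r * (int r + 1)"
proof (induction r)
  case 0
  then show ?case using sum_tent by simp
next
  case (Suc r)
  have "{- int (a + Suc r)..int (a + Suc r)} =
      insert (- int (a + Suc r)) (insert (int (a + Suc r)) {- int (a + r)..int (a + r)})"
    by auto
  then show ?case using Suc.IH by (simp add: algebra_simps)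
qed

lemma sum_diag_weight_le:
  assumes "finite Q" "inj_on f Q"
  shows "(\<Sum>p\<in>Q. diag_weight (int a) (f p)) \<le> 2 * (int a)\<^sup>2"
proof -
  have "(\<Sum>p\<in>Q. diag_weight (int a) (f p)) = (\<Sum>d\<in>f ` Q. diag_weight (int a) d)"
    using assms(2) by (simp add: sum.reindex)
  also have "\<dots> = (\<Sum>d\<in>f ` Q \<inter> {- int a..int a}. diag_weight (int a) d)"
    using assms(1) by (intro sum.mono_neutral_right) (auto simp: diag_weight_def)
  also have "\<dots> \<le> (\<Sum>d\<in>{- int a..int a}. diag_weight (int a) d)"
    by (rule sum_mono2) (auto simp: diag_weight_def)
  also have "\<dots> = 2 * (\<Sum>d\<in>{- int a..int a}. \<bar>\<bar>d\<bar> - int a\<bar>)"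
    unfolding sum_distrib_left by (rule sum.cong) (auto simp: diag_weight_def)
  finally show ?thesis by (simp add: sum_tent)
qed

text \<open>Used in two ways: with \<open>a > 0\<close> for the rows and columns of the whole board, and with
  \<open>a = 0\<close> to bound sums of absolute values of distinct integers from a symmetric interval.\<close>

lemma sum_distinct_tent_le:
  assumes "inj_on f Q" "\<And>p. p \<in> Q \<Longrightarrow> \<bar>f p\<bar> \<le> int (a + r)"
  shows "(\<Sum>p\<in>Q. \<bar>\<bar>f p\<bar> - int a\<bar>) \<le> (int a)\<^sup>2 + int r * (int r + 1)"
proof -
  have "(\<Sum>p\<in>Q. \<bar>\<bar>f p\<bar> - int a\<bar>) = (\<Sum>d\<in>f ` Q. \<bar>\<bar>d\<bar> - int a\<bar>)"
    using assms(1) by (simp add: sum.reindex)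
  also have "\<dots> \<le> (\<Sum>d\<in>{- int (a + r)..int (a + r)}. \<bar>\<bar>d\<bar> - int a\<bar>)"
    using assms(2) by (intro sum_mono2) (fastforce simp: abs_le_iff)+
  finally show ?thesis by (simp only: sum_dist_tent)
qed

text \<open>Only \<open>n \<le> 2 c\<close> is assumed of the centre \<open>c\<close>, so that even and odd boards are treated alike;
  the price is a term linear in \<open>n\<close>.\<close>

lemma sum_line_weight_ge:
  assumes "bij_betw f Q {1..n}" "n \<le> 2 * c" "a + r = c"
  shows "int n * int a - 2 * (int a)\<^sup>2 - 2 * (int r * (int r + 1))
    \<le> (\<Sum>p\<in>Q. line_weight (int a) (int (f p) - int c))"
proof -
  have inj: "inj_on f Q" and img: "f ` Q = {1..n}" using assms(1) by (auto simp: bij_betw_def)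
  have "card Q = n" using bij_betw_same_card[OF assms(1)] by simp
  moreover have "(\<Sum>p\<in>Q. \<bar>\<bar>int (f p) - int c\<bar> - int a\<bar>) \<le> (int a)\<^sup>2 + int r * (int r + 1)"
  proof (rule sum_distinct_tent_le)
    show "inj_on (\<lambda>p. int (f p) - int c) Q" using inj by (auto simp: inj_on_def)
    show "\<bar>int (f p) - int c\<bar> \<le> int (a + r)" if "p \<in> Q" for p
    proof -
      have "f p \<in> {1..n}" using img that by blast
      then show ?thesis using assms(2,3) by auto
    qed
  qed
  ultimately show ?thesis
    by (simp add: line_weight_def sum_subtractf sum_distrib_left[symmetric])
qed

lemma queens_surplus_le:
  assumes Q: "queens n Q" and n: "n \<le> 2 * c" and c: "a + r = c"
  shows "(\<Sum>(i, j)\<in>Q. surplus (int a) (int i - int c) (int j - int c))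
    \<le> 8 * (int a)\<^sup>2 + 4 * (int r * (int r + 1)) - 2 * (int n * int a)"
proof -
  note bij = queens_lines_bij[OF Q]
  have fin: "finite Q" using bij_betw_finite[OF bij(1)] by simp
  have "inj_on (\<lambda>p. (int (fst p) - int c) - (int (snd p) - int c)) Q"
    using bij(3) by (simp add: case_prod_unfold)
  note D = sum_diag_weight_le[OF fin this, of a]
  have "inj_on (\<lambda>p. (int (fst p) - int c) + (int (snd p) - int c)) Q"
    using bij(4) by (simp add: case_prod_unfold inj_on_def algebra_simps)
  note A = sum_diag_weight_le[OF fin this, of a]
  \<comment> \<open>Stated for atoms so that the products and squares below stay opaque to linear arithmetic.\<close>
  have combine: "D + A - R - C \<le> 8 * s + 4 * p - 2 * q"
    if "D \<le> 2 * s" "A \<le> 2 * s" "q - 2 * s - 2 * p \<le> R" "q - 2 * s - 2 * p \<le> C"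
    for D A R C s p q :: int
    using that by linarith
  show ?thesis
    unfolding case_prod_unfold surplus_def sum.distrib sum_subtractf
    by (rule combine[OF D A sum_line_weight_ge[OF bij(1) n c] sum_line_weight_ge[OF bij(2) n c]])
qed

text \<open>All squares added in a completion have nonnegative surplus, so a partial configuration that
  already exceeds the total allowed to a full one is stuck.\<close>

lemma not_completable_if_surplus:
  assumes "Q \<subseteq> board n" "n \<le> 2 * c" "a + r = c"
    and "8 * (int a)\<^sup>2 + 4 * (int r * (int r + 1)) - 2 * (int n * int a)
      < (\<Sum>(i, j)\<in>Q. surplus (int a) (int i - int c) (int j - int c))"
  shows "\<not> completable n Q"
proof
  assume "completable n Q"
  then obtain U where U: "U \<subseteq> board n" "queens n (Q \<union> U)" unfolding completable_def by blast
  have "finite (Q \<union> U)"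
    by (rule finite_subset[of _ "board n"]) (use assms(1) U(1) in \<open>auto simp: board_def\<close>)
  then have "(\<Sum>(i, j)\<in>Q. surplus (int a) (int i - int c) (int j - int c))
    \<le> (\<Sum>(i, j)\<in>Q \<union> U. surplus (int a) (int i - int c) (int j - int c))"
    unfolding case_prod_unfold by (rule sum_mono2) (simp_all add: surplus_nonneg)
  from less_le_trans[OF assms(4) order_trans[OF this queens_surplus_le[OF U(2) assms(2,3)]]]
  show False by simp
qed

section \<open>Queens configurations on every large board\<close>

lemma queens_graphI:
  assumes "\<And>i. 1 \<le> i \<Longrightarrow> i \<le> n \<Longrightarrow> 1 \<le> f i \<and> f i \<le> n"
    and "\<And>i i'. 1 \<le> i \<Longrightarrow> i < i' \<Longrightarrow> i' \<le> n \<Longrightarrow>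
      f i \<noteq> f i' \<and> i + f i' \<noteq> i' + f i \<and> i + f i \<noteq> i' + f i'"
  shows "queens n ((\<lambda>i. (i, f i)) ` {1..n})"
  unfolding queens_def partial_queens_iff
proof (intro conjI allI impI)
  show "(\<lambda>i. (i, f i)) ` {1..n} \<subseteq> board n" using assms(1) by (auto simp: board_def)
  show "card ((\<lambda>i. (i, f i)) ` {1..n}) = n" by (simp add: card_image inj_on_def)
  fix i j i' j'
  assume "(i, j) \<in> (\<lambda>i. (i, f i)) ` {1..n}" "(i', j') \<in> (\<lambda>i. (i, f i)) ` {1..n}"
    and "(i, j) \<noteq> (i', j')"
  then have "i \<noteq> i'" and ij: "j = f i" "j' = f i'" "1 \<le> i" "i \<le> n" "1 \<le> i'" "i' \<le> n" by auto
  then consider "i < i'" | "i' < i" by linarith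
  then have "f i \<noteq> f i' \<and> i + f i' \<noteq> i' + f i \<and> i + f i \<noteq> i' + f i'"
    using assms(2)[of i i'] assms(2)[of i' i] ij(3-6) by cases metis+
  then show "i \<noteq> i'" "j \<noteq> j'" "i + j' \<noteq> i' + j" "i + j \<noteq> i' + j'"
    using \<open>i \<noteq> i'\<close> ij(1,2) by simp_all
qed

text \<open>The first classical configuration consists of the two lines \<open>j = 2 i\<close> and
  \<open>j = 2 (i - h) - 1\<close>.  Two queens of different lines meet on an anti-diagonal only if
  \<open>3 (i' - i) = 2 h + 1\<close>, which is why \<open>h mod 3 = 1\<close> is excluded.\<close>

definition stair_column :: "nat \<Rightarrow> nat \<Rightarrow> nat" where
  "stair_column h i = (if i \<le> h then 2 * i else 2 * i - 2 * h - 1)"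

definition stairs :: "nat \<Rightarrow> square set" where
  "stairs h = (\<lambda>i. (i, stair_column h i)) ` {1..2 * h}"

lemma stair_column_cases:
  assumes "1 \<le> i" "i \<le> 2 * h"
  obtains "i \<le> h" "stair_column h i = 2 * i"
  | "h < i" "stair_column h i + 2 * h + 1 = 2 * i"
  using assms by (cases "i \<le> h") (auto simp: stair_column_def)

lemma queens_stairs:
  assumes "h mod 3 \<noteq> 1"
  shows "queens (2 * h) (stairs h)"
  unfolding stairs_def
proof (rule queens_graphI)
  show "1 \<le> stair_column h i \<and> stair_column h i \<le> 2 * h" if "1 \<le> i" "i \<le> 2 * h" for i
    using that by (cases rule: stair_column_cases) (use that in linarith | intro conjI)+
next
  fix i i' assume i: "1 \<le> i" "i < i'" "i' \<le> 2 * h"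
  have 1: "1 \<le> i'" "i \<le> 2 * h" using i by linarith+
  show "stair_column h i \<noteq> stair_column h i' \<and> i + stair_column h i' \<noteq> i' + stair_column h i \<and>
      i + stair_column h i \<noteq> i' + stair_column h i'"
  proof (cases rule: stair_column_cases[OF i(1) 1(2)]; cases rule: stair_column_cases[OF 1(1) i(3)])
    assume a: "i \<le> h" "stair_column h i = 2 * i" "h < i'" "stair_column h i' + 2 * h + 1 = 2 * i'"
    have "3 * i' \<noteq> 3 * i + 2 * h + 1" using assms by presburger
    moreover have "2 * i' \<noteq> 2 * i + 2 * h + 1" by presburger
    ultimately show ?thesis using a i by linarith
  qed (use i in linarith)+
qed

lemma stairs_off_diagonal: "(i, i) \<notin> stairs h"
proof
  assume "(i, i) \<in> stairs h"
  then have i: "1 \<le> i" "i \<le> 2 * h" "stair_column h i = i" unfolding stairs_def by auto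
  from i(1,2) show False by (cases rule: stair_column_cases) (use i in linarith)+
qed

text \<open>For \<open>h mod 3 = 1\<close> the upper half of the board is filled by one line of slope two that starts
  near the middle column and wraps around once, and the lower half is its image under rotation of
  the board by a half turn.  Each half has two pieces, hence four cases.\<close>

definition wrapped_stair_column :: "nat \<Rightarrow> nat \<Rightarrow> nat" where
  "wrapped_stair_column h i =
    (if 2 * i \<le> h + 2 then 2 * i + h - 2
     else if i \<le> h then 2 * i - h - 2
     else if 2 * i < 3 * h then 2 * i + 1 - h
     else 2 * i + 1 - 3 * h)"

definition wrapped_stairs :: "nat \<Rightarrow> square set" where
  "wrapped_stairs h = (\<lambda>i. (i, wrapped_stair_column h i)) ` {1..2 * h}"

lemma wrapped_stair_column_cases:
  assumes "1 \<le> i" "i \<le> 2 * h"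
  obtains "2 * i \<le> h + 2" "wrapped_stair_column h i + 2 = 2 * i + h"
  | "h + 2 < 2 * i" "i \<le> h" "wrapped_stair_column h i + h + 2 = 2 * i"
  | "h < i" "2 * i < 3 * h" "wrapped_stair_column h i + h = 2 * i + 1"
  | "h < i" "3 * h \<le> 2 * i" "wrapped_stair_column h i + 3 * h = 2 * i + 1"
proof -
  consider "2 * i \<le> h + 2" | "h + 2 < 2 * i" "i \<le> h" | "h < i" "2 * i < 3 * h"
    | "h < i" "3 * h \<le> 2 * i" "h + 2 < 2 * i" | "h < i" "2 * i \<le> h + 2"
    using assms by linarith
  then show thesis using assms by cases (auto simp: wrapped_stair_column_def intro: that)
qed

lemma queens_wrapped_stairs:
  assumes "h mod 3 = 1" "4 \<le> h"
  shows "queens (2 * h) (wrapped_stairs h)"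
  unfolding wrapped_stairs_def
proof (rule queens_graphI)
  show "1 \<le> wrapped_stair_column h i \<and> wrapped_stair_column h i \<le> 2 * h"
    if "1 \<le> i" "i \<le> 2 * h" for i
    using that by (cases rule: wrapped_stair_column_cases) (use assms that in auto)
next
  fix i i' assume i: "1 \<le> i" "i < i'" "i' \<le> 2 * h"
  have 1: "1 \<le> i'" "i \<le> 2 * h" using i by linarith+
  have "h = 3 * (h div 3) + 1" using assms(1) by presburger
  then obtain k where k: "h = 3 * k + 1" ..
  have k1: "1 \<le> k" using k assms(2) by linarith
  \<comment> \<open>Queens in different halves have columns of different parity; two pieces can share an
    anti-diagonal only if 3 divides \<open>h\<close>.  All other coincidences are excluded by the size of the
    coordinates.\<close>
  have parity: False if "x + x = y + y + 1" for x y :: nat using that by presburger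
  have mod1: False if "x + x + x = y + y + y + 1" for x y :: nat using that by presburger
  have mod2: False if "x + x + x = y + y + y + 2" for x y :: nat using that by presburger
  show "wrapped_stair_column h i \<noteq> wrapped_stair_column h i' \<and>
      i + wrapped_stair_column h i' \<noteq> i' + wrapped_stair_column h i \<and>
      i + wrapped_stair_column h i \<noteq> i' + wrapped_stair_column h i'"
    by (cases rule: wrapped_stair_column_cases[OF i(1) 1(2)];
        cases rule: wrapped_stair_column_cases[OF 1(1) i(3)];
        intro conjI notI;
        insert i k k1;
        (linarith
          | (rule parity[of "i + h" "i' + 1"]; linarith)
          | (rule parity[of "i + 2 * h" "i' + 1"]; linarith)
          | (rule parity[of i "i' + 1"]; linarith)
          | (rule mod1[of "i + 2 * k" i']; linarith)
          | (rule mod1[of i' "i + 4 * k"]; linarith)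
          | (rule mod2[of i' "i + 2 * k"]; linarith)))
qed

lemma wrapped_stairs_off_diagonal:
  assumes "4 \<le> h"
  shows "(i, i) \<notin> wrapped_stairs h"
proof
  assume "(i, i) \<in> wrapped_stairs h"
  then have i: "1 \<le> i" "i \<le> 2 * h" "wrapped_stair_column h i = i"
    unfolding wrapped_stairs_def by auto
  from i(1,2) show False
    by (cases rule: wrapped_stair_column_cases) (use i assms in linarith)+
qed

text \<open>The corner of the enlarged board lies in a new row and a new column and is alone on its
  anti-diagonal, so only the main diagonal has to be free, as it is in both even configurations.\<close>

lemma queens_insert_corner:
  assumes "queens m Q" "\<And>i. (i, i) \<notin> Q"
  shows "queens (Suc m) (insert (Suc m, Suc m) Q)"
proof -
  have pq: "partial_queens m Q" and card: "card Q = m" using assms(1) by (auto simp: queens_def)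
  have range: "1 \<le> i \<and> i \<le> m \<and> 1 \<le> j \<and> j \<le> m \<and> i \<noteq> j" if "(i, j) \<in> Q" for i j
    using partial_queens_on_board[OF pq] that assms(2) by (auto simp: board_def)
  have "finite Q" by (rule finite_subset[OF partial_queens_on_board[OF pq]]) (simp add: board_def)
  moreover have "(Suc m, Suc m) \<notin> Q" by (rule assms(2))
  ultimately have "card (insert (Suc m, Suc m) Q) = Suc m" using card by simp
  moreover have "insert (Suc m, Suc m) Q \<subseteq> board (Suc m)"
    using partial_queens_on_board[OF pq] by (auto simp: board_def)
  moreover have "i \<noteq> i' \<and> j \<noteq> j' \<and> i + j' \<noteq> i' + j \<and> i + j \<noteq> i' + j'"
    if ins: "(i, j) \<in> insert (Suc m, Suc m) Q" "(i', j') \<in> insert (Suc m, Suc m) Q"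
      and ne: "(i, j) \<noteq> (i', j')" for i j i' j'
  proof -
    consider "(i, j) \<in> Q" "(i', j') \<in> Q" | "(i, j) \<in> Q" "i' = Suc m" "j' = Suc m"
      | "(i', j') \<in> Q" "i = Suc m" "j = Suc m"
      using ins ne by blast
    then show ?thesis
    proof cases
      case 1
      then show ?thesis using partial_queens_not_attacking[OF pq 1 ne] by blast
    next
      case 2
      then show ?thesis using range[OF 2(1)] by auto
    next
      case 3
      then show ?thesis using range[OF 3(1)] by auto
    qed
  qed
  ultimately show ?thesis unfolding queens_def partial_queens_iff by blast
qed

lemma queens_exists:
  assumes "8 \<le> n"
  shows "\<exists>Q. queens n Q"
proof -
  define h where "h = n div 2"
  have h: "4 \<le> h" using assms by (simp add: h_def)
  obtain Q where Q: "queens (2 * h) Q" "\<And>i. (i, i) \<notin> Q"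
  proof (cases "h mod 3 = 1")
    case True
    show thesis
      by (rule that[OF queens_wrapped_stairs[OF True h] wrapped_stairs_off_diagonal[OF h]])
  next
    case False
    show thesis by (rule that[OF queens_stairs[OF False] stairs_off_diagonal])
  qed
  have "n = 2 * h \<or> n = Suc (2 * h)" unfolding h_def by presburger
  then show ?thesis using Q(1) queens_insert_corner[OF Q] by auto
qed

section \<open>A central block of queens\<close>

lemma partial_queens_shift:
  assumes "partial_queens m Q" "s + m \<le> n"
  shows "partial_queens n ((\<lambda>(i, j). (s + i, s + j)) ` Q)"
proof -
  have "(\<lambda>(i, j). (s + i, s + j)) ` Q \<subseteq> board n"
    using partial_queens_on_board[OF assms(1)] assms(2) by (force simp: board_def)
  moreover have "i \<noteq> i' \<and> j \<noteq> j' \<and> i + j' \<noteq> i' + j \<and> i + j \<noteq> i' + j'"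
    if sh: "(i, j) \<in> (\<lambda>(i, j). (s + i, s + j)) ` Q" "(i', j') \<in> (\<lambda>(i, j). (s + i, s + j)) ` Q"
      and ne: "(i, j) \<noteq> (i', j')" for i j i' j'
  proof -
    obtain k l where kl: "(k, l) \<in> Q" "i = s + k" "j = s + l" using sh(1) by auto
    obtain k' l' where kl': "(k', l') \<in> Q" "i' = s + k'" "j' = s + l'" using sh(2) by auto
    have "(k, l) \<noteq> (k', l')" using ne kl kl' by auto
    then have "k \<noteq> k' \<and> l \<noteq> l' \<and> k + l' \<noteq> k' + l \<and> k + l \<noteq> k' + l'"
      by (rule partial_queens_not_attacking[OF assms(1) kl(1) kl'(1)])
    then show ?thesis using kl kl' by linarith
  qed
  ultimately show ?thesis unfolding partial_queens_iff by blast
qed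

lemma sum_dist_interval:
  "2 * (\<Sum>i\<in>{p + 1..p + (q + r)}. \<bar>int i - int (p + q)\<bar>) = int q * (int q - 1) + int r * (int r + 1)"
proof -
  have gauss: "2 * (\<Sum>i\<in>{1..q}. int i) = int q * (int q + 1)"
    by (induction q) (simp_all add: algebra_simps)
  have "(\<Sum>i\<in>{1..q}. \<bar>int i - int q\<bar>) = (\<Sum>i\<in>{1..q}. int q - int i)"
    by (rule sum.cong) auto
  then have base: "2 * (\<Sum>i\<in>{1..q}. \<bar>int i - int q\<bar>) = int q * (int q - 1)"
    using gauss by (simp add: sum_subtractf algebra_simps)
  have "2 * (\<Sum>i\<in>{1..q + r}. \<bar>int i - int q\<bar>) = int q * (int q - 1) + int r * (int r + 1)"
    by (induction r) (use base in \<open>simp_all add: algebra_simps\<close>)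
  moreover have "(\<Sum>i\<in>{p + 1..p + (q + r)}. \<bar>int i - int (p + q)\<bar>) = (\<Sum>i\<in>{1..q + r}. \<bar>int i - int q\<bar>)"
    using sum.shift_bounds_cl_nat_ivl[of "\<lambda>i. \<bar>int i - int (p + q)\<bar>" 1 p "q + r"]
    by (simp add: add.commute)
  ultimately show ?thesis by simp
qed

text \<open>Along either line \<open>x + y\<close> grows in steps of three, over an interval that is off centre: one
  line gives \<open>3 (i - 2 g)\<close> with \<open>i \<le> 3 g\<close>, the other \<open>3 (i - 4 g) - 1\<close> with \<open>i > 3 g\<close>.\<close>

lemma stairs_antidiagonal_spread:
  "(\<Sum>(i, j)\<in>stairs (3 * g). \<bar>int i + int j - 6 * int g\<bar>) \<le> 15 * (int g)\<^sup>2 + 3 * int g"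
proof -
  let ?d = "\<lambda>i. \<bar>int i + int (stair_column (3 * g) i) - 6 * int g\<bar>"
  have "(\<Sum>(i, j)\<in>stairs (3 * g). \<bar>int i + int j - 6 * int g\<bar>) = (\<Sum>i\<in>{1..6 * g}. ?d i)"
    unfolding stairs_def by (subst sum.reindex) (auto simp: inj_on_def)
  also have "{1..6 * g} = {1..3 * g} \<union> {3 * g + 1..6 * g}" by auto
  also have "(\<Sum>i\<in>{1..3 * g} \<union> {3 * g + 1..6 * g}. ?d i)
      = (\<Sum>i\<in>{1..3 * g}. ?d i) + (\<Sum>i\<in>{3 * g + 1..6 * g}. ?d i)"
    by (rule sum.union_disjoint) auto
  also have "(\<Sum>i\<in>{1..3 * g}. ?d i) = 3 * (\<Sum>i\<in>{1..3 * g}. \<bar>int i - int (2 * g)\<bar>)"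
    unfolding sum_distrib_left
  proof (rule sum.cong)
    fix i assume "i \<in> {1..3 * g}"
    then have "?d i = \<bar>3 * (int i - int (2 * g))\<bar>" by (simp add: stair_column_def)
    then show "?d i = 3 * \<bar>int i - int (2 * g)\<bar>"
      by (simp only: abs_mult abs_numeral)
  qed simp
  also have "(\<Sum>i\<in>{3 * g + 1..6 * g}. ?d i)
      \<le> (\<Sum>i\<in>{3 * g + 1..6 * g}. 3 * \<bar>int i - int (4 * g)\<bar> + 1)"
  proof (rule sum_mono)
    fix i assume i: "i \<in> {3 * g + 1..6 * g}"
    then have "?d i = \<bar>3 * (int i - int (4 * g)) - 1\<bar>" by (simp add: stair_column_def of_nat_diff)
    also have "\<dots> \<le> \<bar>3 * (int i - int (4 * g))\<bar> + 1" by (rule order_trans[OF abs_triangle_ineq4]) simp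
    also have "\<dots> = 3 * \<bar>int i - int (4 * g)\<bar> + 1" by (simp only: abs_mult abs_numeral)
    finally show "?d i \<le> 3 * \<bar>int i - int (4 * g)\<bar> + 1" .
  qed
  also have "\<dots> = 3 * (\<Sum>i\<in>{3 * g + 1..6 * g}. \<bar>int i - int (4 * g)\<bar>) + 3 * int g"
    by (simp add: sum.distrib sum_distrib_left)
  finally show ?thesis
    using sum_dist_interval[of 0 "2 * g" g] sum_dist_interval[of "3 * g" g "2 * g"]
    by (simp add: power2_eq_square algebra_simps)
qed

text \<open>With \<open>k = 6 g\<close> queens the leading term is \<open>42 g\<^sup>2 = 7/6 k\<^sup>2\<close>: the row, column and difference
  coordinates are distinct integers in an interval of length \<open>k\<close> and contribute \<open>k\<^sup>2 / 4\<close> each,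
  the sum coordinate contributes \<open>5/12 k\<^sup>2\<close>.\<close>

lemma stairs_spread:
  "(\<Sum>(i, j)\<in>stairs (3 * g). \<bar>int i - 3 * int g\<bar> + \<bar>int j - 3 * int g\<bar>
      + \<bar>int i - int j\<bar> + \<bar>int i + int j - 6 * int g\<bar>) \<le> 42 * (int g)\<^sup>2 + 12 * int g"
proof -
  have "queens (2 * (3 * g)) (stairs (3 * g))" by (rule queens_stairs) simp
  note bij = queens_lines_bij[OF this]
  have "(\<Sum>p\<in>stairs (3 * g). \<bar>f p\<bar>) \<le> 9 * (int g)\<^sup>2 + 3 * int g"
    if "inj_on f (stairs (3 * g))" "\<And>p. p \<in> stairs (3 * g) \<Longrightarrow> \<bar>f p\<bar> \<le> int (3 * g)" for f
    using sum_distinct_tent_le[where f = f and a = 0 and r = "3 * g"] that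
    by (simp add: power2_eq_square algebra_simps)
  note spread = this
  have bound: "i \<in> {1..2 * (3 * g)} \<and> j \<in> {1..2 * (3 * g)}" if "(i, j) \<in> stairs (3 * g)" for i j
    using that bij(1,2) unfolding bij_betw_def by force
  have R: "(\<Sum>p\<in>stairs (3 * g). \<bar>int (fst p) - 3 * int g\<bar>) \<le> 9 * (int g)\<^sup>2 + 3 * int g"
  proof (rule spread)
    show "inj_on (\<lambda>p. int (fst p) - 3 * int g) (stairs (3 * g))"
      using bij_betw_imp_inj_on[OF bij(1)] by (simp add: inj_on_def)
    show "\<bar>int (fst p) - 3 * int g\<bar> \<le> int (3 * g)" if "p \<in> stairs (3 * g)" for p
      using bound[of "fst p" "snd p"] that by auto
  qed
  have C: "(\<Sum>p\<in>stairs (3 * g). \<bar>int (snd p) - 3 * int g\<bar>) \<le> 9 * (int g)\<^sup>2 + 3 * int g"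
  proof (rule spread)
    show "inj_on (\<lambda>p. int (snd p) - 3 * int g) (stairs (3 * g))"
      using bij_betw_imp_inj_on[OF bij(2)] by (simp add: inj_on_def)
    show "\<bar>int (snd p) - 3 * int g\<bar> \<le> int (3 * g)" if "p \<in> stairs (3 * g)" for p
      using bound[of "fst p" "snd p"] that by auto
  qed
  have D: "(\<Sum>p\<in>stairs (3 * g). \<bar>int (fst p) - int (snd p)\<bar>) \<le> 9 * (int g)\<^sup>2 + 3 * int g"
  proof (rule spread)
    show "inj_on (\<lambda>p. int (fst p) - int (snd p)) (stairs (3 * g))"
      using bij(3) by (simp add: case_prod_unfold)
    show "\<bar>int (fst p) - int (snd p)\<bar> \<le> int (3 * g)" if "p \<in> stairs (3 * g)" for p
      using that unfolding stairs_def by (auto simp: stair_column_def of_nat_diff)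
  qed
  from R C D stairs_antidiagonal_spread[of g] show ?thesis
    by (simp add: case_prod_unfold sum.distrib)
qed

text \<open>The shift takes the centre \<open>3 g\<close> of the stairs to \<open>c\<close>.\<close>

definition central_block :: "nat \<Rightarrow> nat \<Rightarrow> square set" where
  "central_block c g = (\<lambda>(i, j). (c - 3 * g + i, c - 3 * g + j)) ` stairs (3 * g)"

lemma central_block_partial_queens:
  assumes "3 * g \<le> c" "c + 3 * g \<le> n"
  shows "partial_queens n (central_block c g)" "card (central_block c g) = 6 * g"
proof -
  have q: "queens (2 * (3 * g)) (stairs (3 * g))" by (rule queens_stairs) simp
  show "partial_queens n (central_block c g)" unfolding central_block_def
    by (rule partial_queens_shift[of "2 * (3 * g)"]) (use q assms in \<open>auto simp: queens_def\<close>)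
  have "inj_on (\<lambda>(i, j). (c - 3 * g + i, c - 3 * g + j)) (stairs (3 * g))"
    by (auto simp: inj_on_def)
  then show "card (central_block c g) = 6 * g"
    unfolding central_block_def using q by (simp add: card_image queens_def)
qed

lemma central_block_surplus:
  assumes "3 * g \<le> c"
  shows "36 * (int a * int g) - 84 * (int g)\<^sup>2 - 24 * int g
    \<le> (\<Sum>(i, j)\<in>central_block c g. surplus (int a) (int i - int c) (int j - int c))"
proof -
  let ?x = "\<lambda>p. int (fst p) - 3 * int g" and ?y = "\<lambda>p. int (snd p) - 3 * int g"
  have q: "queens (2 * (3 * g)) (stairs (3 * g))" by (rule queens_stairs) simp
  have "inj_on (\<lambda>(i, j). (c - 3 * g + i, c - 3 * g + j)) (stairs (3 * g))"
    by (auto simp: inj_on_def)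
  then have eq: "(\<Sum>(i, j)\<in>central_block c g. surplus (int a) (int i - int c) (int j - int c))
      = (\<Sum>p\<in>stairs (3 * g). surplus (int a) (?x p) (?y p))"
    unfolding central_block_def using assms
    by (simp add: sum.reindex case_prod_unfold of_nat_diff)
  let ?S = "\<Sum>p\<in>stairs (3 * g). \<bar>?x p\<bar> + \<bar>?y p\<bar> + \<bar>?x p - ?y p\<bar> + \<bar>?x p + ?y p\<bar>"
  have "card (stairs (3 * g)) = 6 * g" using q by (simp add: queens_def)
  then have "36 * (int a * int g) - 2 * ?S = (\<Sum>p\<in>stairs (3 * g).
      6 * int a - 2 * (\<bar>?x p\<bar> + \<bar>?y p\<bar> + \<bar>?x p - ?y p\<bar> + \<bar>?x p + ?y p\<bar>))"
    unfolding sum_subtractf sum_distrib_left[symmetric] by simp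
  also have "\<dots> \<le> (\<Sum>p\<in>stairs (3 * g). surplus (int a) (?x p) (?y p))"
    by (rule sum_mono) (rule surplus_ge)
  finally have "36 * (int a * int g) - 2 * ?S
      \<le> (\<Sum>p\<in>stairs (3 * g). surplus (int a) (?x p) (?y p))" .
  moreover have "?S \<le> 42 * (int g)\<^sup>2 + 12 * int g"
    using stairs_spread[of g] by (simp add: case_prod_unfold algebra_simps)
  ultimately show ?thesis unfolding eq by linarith
qed

section \<open>The threshold\<close>

lemma qc_less_card:
  assumes "\<exists>Q. queens n Q" "partial_queens n Q" "\<not> completable n Q" "0 < n"
  shows "qc n < card Q"
proof -
  let ?K = "{k. k < n \<and> (\<forall>Q. partial_queens n Q \<and> card Q \<le> k \<longrightarrow> completable n Q)}"
  have "completable n P" if "partial_queens n P" "card P \<le> 0" for P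
  proof -
    have "finite P"
      by (rule finite_subset[of _ "board n"]) (use that(1) in \<open>auto simp: partial_queens_def board_def\<close>)
    then have "P = {}" using that(2) by simp
    then show ?thesis
      using assms(1) unfolding completable_def by (auto simp: queens_def partial_queens_def)
  qed
  then have "0 \<in> ?K" using assms(4) by auto
  moreover have "finite ?K" by simp
  ultimately have "qc n \<in> ?K" unfolding qc_def by (intro Max_in) auto
  then show ?thesis using assms(2,3) by (auto simp: not_le[symmetric])
qed

text \<open>With \<open>c \<approx> n/2\<close> and \<open>k = 6 g\<close> the optimal \<open>a = (n + k)/4\<close> is \<open>(c + 3 g)/2\<close>, which for
  \<open>c \<approx> 528 t\<close> and \<open>g = 38 t\<close> is \<open>321 t\<close>.  The two sides of the surplus comparison are then
  \<open>317772 t\<^sup>2\<close> and \<open>317832 t\<^sup>2\<close> up to terms linear in \<open>t\<close>; the narrow gap makes \<open>t\<close> large.\<close>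

lemma central_block_not_completable:
  assumes "4000 \<le> t" "\<rho> < 528" "1056 * t + 2 * \<rho> \<le> n + 1" "n \<le> 1056 * t + 2 * \<rho>"
  shows "\<not> completable n (central_block (528 * t + \<rho>) (38 * t))"
proof (rule not_completable_if_surplus)
  let ?c = "528 * t + \<rho>"
  show "central_block ?c (38 * t) \<subseteq> board n"
    using central_block_partial_queens(1)[of "38 * t" ?c n] assms
    by (simp add: partial_queens_def)
  show "n \<le> 2 * ?c" using assms(4) by simp
  show "321 * t + (207 * t + \<rho>) = ?c" by simp
  have t: "4000 * int t \<le> int t * int t" using assms(1) by (intro mult_right_mono) auto
  have tr: "int t * int \<rho> \<le> int t * 527" using assms(2) by (intro mult_left_mono) auto
  have rr: "int \<rho> * int \<rho> \<le> 527 * 527" using assms(2) by (intro mult_mono) auto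
  have n: "(2 * int ?c - 1) * int (321 * t) \<le> int n * int (321 * t)"
    using assms(3) by (intro mult_right_mono) auto
  have "8 * (int (321 * t))\<^sup>2 + 4 * (int (207 * t + \<rho>) * (int (207 * t + \<rho>) + 1)) - 2 * (int n * int (321 * t))
     \<le> 317772 * (int t * int t) + 372 * (int t * int \<rho>) + 1470 * int t + 4 * (int \<rho> * int \<rho>) + 4 * int \<rho>"
    using n by (simp add: power2_eq_square algebra_simps)
  also have "\<dots> < 317832 * (int t * int t) - 912 * int t"
    using t tr rr assms(1,2) by linarith
  also have "\<dots> = 36 * (int (321 * t) * int (38 * t)) - 84 * (int (38 * t))\<^sup>2 - 24 * int (38 * t)"
    by (simp add: power2_eq_square algebra_simps)
  also have "\<dots> \<le> (\<Sum>(i, j)\<in>central_block ?c (38 * t). surplus (int (321 * t)) (int i - int ?c) (int j - int ?c))"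
    by (rule central_block_surplus) simp
  finally show "8 * (int (321 * t))\<^sup>2 + 4 * (int (207 * t + \<rho>) * (int (207 * t + \<rho>) + 1)) - 2 * (int n * int (321 * t))
    < (\<Sum>(i, j)\<in>central_block ?c (38 * t). surplus (int (321 * t)) (int i - int ?c) (int j - int ?c))" .
qed

theorem theorem2:
  shows "\<exists>n0::nat. \<forall>n\<ge>n0. real (qc n) < 0.216 * real n"
proof (intro exI allI impI)
  fix n :: nat assume n: "4224000 \<le> n"
  define t where "t = (n + 1) div 2 div 528"
  define \<rho> where "\<rho> = (n + 1) div 2 mod 528"
  have c: "(n + 1) div 2 = 528 * t + \<rho>" unfolding t_def \<rho>_def by simp
  have cn: "1056 * t + 2 * \<rho> \<le> n + 1" "n \<le> 1056 * t + 2 * \<rho>" using c by linarith+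
  have \<rho>: "\<rho> < 528" unfolding \<rho>_def by simp
  have t: "4000 \<le> t" using n cn \<rho> by linarith
  have block: "partial_queens n (central_block (528 * t + \<rho>) (38 * t))"
    "card (central_block (528 * t + \<rho>) (38 * t)) = 228 * t"
    using central_block_partial_queens[of "38 * t" "528 * t + \<rho>" n] cn t by simp_all
  have "qc n < card (central_block (528 * t + \<rho>) (38 * t))"
    by (rule qc_less_card[OF queens_exists block(1) central_block_not_completable[OF t \<rho> cn]])
      (use n in simp_all)
  then have "real (qc n) < 228 * real t" using block(2) by simp
  moreover have "1056 * real t \<le> real n + 1" using cn(1) by linarith
  ultimately show "real (qc n) < 0.216 * real n" using t by simp
qed

end
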